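(* The spaces $(\mathfrak{C}, \diamond)$ and $(\mathfrak{C}, \sqcup\!\sqcup)$ are commutative $\mathbb F_q$-algebras (with unit the empty word $1$). In particular, Conjecture 3.2.2 of Shi's thesis (asserting that the shuffle product $\sqcup\!\sqcup$ on $\mathfrak C$ is associative) holds.
   Context: Let $\mathbb F_q$ be the finite field with $q$ elements, of characteristic $p$. Let $\Sigma=\{x_n\}_{n\geq 1}$ be an alphabet with weight $w(x_n)=n$; let $\langle\Sigma\rangle$ be the set of words over $\Sigma$ (the empty word is denoted $1$), and let $\mathfrak C=\mathbb F_q\langle\Sigma\rangle$ be the $\mathbb F_q$-vector space with basis $\langle\Sigma\rangle$, equipped with concatenation. A nonempty word is written $\mathfrak a=x_a\mathfrak a_-$, where $x_a$ is its first letter. For $a,b,i\in\mathbb N$ put $\Delta^i_{a,b}=(-1)^{a-1}\binom{i-1}{a-1}+(-1)^{b-1}\binom{i-1}{b-1}\in\mathbb F_p$ if $(q-1)\mid i$ and $0<i<a+b$, and $\Delta^i_{a,b}=0$ otherwise. Define $\mathbb F_q$-bilinear products $\diamond$ (diamond product) and $\sqcup\!\sqcup$ (shuffle product) on $\mathfrak C$ recursively by $1\diamond\mathfrak a=\mathfrak a\diamond 1=\mathfrak a$, $1\sqcup\!\sqcup\mathfrak a=\mathfrak a\sqcup\!\sqcup 1=\mathfrak a$, and for nonempty words $\mathfrak a,\mathfrak b$: $\mathfrak a\diamond\mathfrak b=x_{a+b}(\mathfrak a_-\sqcup\!\sqcup\mathfrak b_-)+\sum_{i+j=a+b}\Delta^j_{a,b}\,x_i(x_j\sqcup\!\sqcup(\mathfrak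 a_-\sqcup\!\sqcup\mathfrak b_-))$, $\mathfrak a\sqcup\!\sqcup\mathfrak b=x_a(\mathfrak a_-\sqcup\!\sqcup\mathfrak b)+x_b(\mathfrak a\sqcup\!\sqcup\mathfrak b_-)+\mathfrak a\diamond\mathfrak b$. *)

theory Defs
  imports "HOL-Algebra.Module" "HOL-Library.Poly_Mapping" "HOL-Library.Cardinality"
begin

typedef letter = "{n::nat. 0 < n}"
  morphisms wt Letter
  by blast

text \<open>\<^term>\<open>Letter n\<close> is the letter $x_n$; it is only meaningful for \<^prop>\<open>0 < n\<close>.\<close>

type_synonym word = "letter list"

text \<open>The space with basis the words: finitely supported functions from words to the field.\<close>

type_synonym 'k words = "word \<Rightarrow>\<^sub>0 'k"

definition word_wt :: "word \<Rightarrow> nat" where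
  "word_wt u = sum_list (map wt u)"

definition basis :: "word \<Rightarrow> 'k::{field,finite} words" where
  "basis u = Poly_Mapping.single u 1"

definition scale :: "'k::{field,finite} \<Rightarrow> 'k words \<Rightarrow> 'k words" where
  "scale c P = Poly_Mapping.map ((*) c) P"

definition bilin ::
  "(word \<Rightarrow> word \<Rightarrow> 'k::{field,finite} words) \<Rightarrow> 'k words \<Rightarrow> 'k words \<Rightarrow> 'k words" where
  "bilin f P Q = (\<Sum>u\<in>Poly_Mapping.keys P. \<Sum>v\<in>Poly_Mapping.keys Q.
     scale (Poly_Mapping.lookup P u * Poly_Mapping.lookup Q v) (f u v))"

definition conc :: "'k::{field,finite} words \<Rightarrow> 'k words \<Rightarrow> 'k words"  (infixr \<open>\<cdot>\<close> 75) where
  "P \<cdot> Q = bilin (\<lambda>u v. basis (u @ v)) P Q"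

abbreviation gen :: "nat \<Rightarrow> 'k::{field,finite} words" where
  "gen n \<equiv> basis [Letter n]"

text \<open>\<open>Delta a b i\<close> is $\Delta^i_{a,b}$ for $a, b \geq 1$, taken in the field itself via the embedding
  of its prime field; $q$ is the cardinality of the field.\<close>

definition Delta :: "nat \<Rightarrow> nat \<Rightarrow> nat \<Rightarrow> 'k::{field,finite}" where
  "Delta a b i =
     (if (CARD('k) - 1) dvd i \<and> 0 < i \<and> i < a + b
      then (-1) ^ (a - 1) * of_nat ((i - 1) choose (a - 1))
         + (-1) ^ (b - 1) * of_nat ((i - 1) choose (b - 1))
      else 0)"

lemma wt_pos [simp]: "0 < wt a"
  using wt by blast

lemma wt_Letter [simp]: "0 < n \<Longrightarrow> wt (Letter n) = n"
  by (simp add: Letter_inverse)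

lemma word_wt_simps [simp]:
  "word_wt [] = 0" "word_wt (a # u) = wt a + word_wt u" "word_wt (u @ v) = word_wt u + word_wt v"
  by (simp_all add: word_wt_def)

lemma keys_basis [simp]: "Poly_Mapping.keys (basis u :: 'k::{field,finite} words) = {u}"
  by (simp add: basis_def)

lemma lookup_scale [simp]:
  "Poly_Mapping.lookup (scale c P) u = c * Poly_Mapping.lookup P u"
  unfolding scale_def by (simp add: Poly_Mapping.map.rep_eq when_def)

lemma keys_scale: "Poly_Mapping.keys (scale c P) \<subseteq> Poly_Mapping.keys P"
  by (auto simp: in_keys_iff)

lemma keys_bilin:
  "Poly_Mapping.keys (bilin f P Q) \<subseteq>
     (\<Union>u\<in>Poly_Mapping.keys P. \<Union>v\<in>Poly_Mapping.keys Q. Poly_Mapping.keys (f u v))"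
  unfolding bilin_def
  by (intro order_trans[OF keys_sum] UN_mono order_refl order_trans[OF keys_scale])

lemma bilin_cong [fundef_cong]:
  assumes "P = P'" "Q = Q'"
    and "\<And>u v. u \<in> Poly_Mapping.keys P' \<Longrightarrow> v \<in> Poly_Mapping.keys Q' \<Longrightarrow> f u v = g u v"
  shows "bilin f P Q = bilin g P' Q'"
  using assms by (auto simp: bilin_def intro!: sum.cong)

definition homog :: "nat \<Rightarrow> 'k::{field,finite} words \<Rightarrow> bool" where
  "homog n P \<longleftrightarrow> (\<forall>w\<in>Poly_Mapping.keys P. word_wt w = n)"

lemma homog_basis: "word_wt u = n \<Longrightarrow> homog n (basis u)"
  by (simp add: homog_def)

lemma homog_add: "homog n P \<Longrightarrow> homog n Q \<Longrightarrow> homog n (P + Q)"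
  unfolding homog_def using Poly_Mapping.keys_add[of P Q] by blast

lemma homog_scale: "homog n P \<Longrightarrow> homog n (scale c P)"
  unfolding homog_def using keys_scale by blast

lemma homog_sum: "(\<And>i. i \<in> I \<Longrightarrow> homog n (f i)) \<Longrightarrow> homog n (sum f I)"
  unfolding homog_def using keys_sum[of f I] by blast

lemma homog_bilin:
  assumes "\<And>u v. u \<in> Poly_Mapping.keys P \<Longrightarrow> v \<in> Poly_Mapping.keys Q \<Longrightarrow> homog n (f u v)"
  shows "homog n (bilin f P Q)"
  using assms keys_bilin[of f P Q] unfolding homog_def by blast

lemma homog_conc: "homog k P \<Longrightarrow> homog m Q \<Longrightarrow> k + m = n \<Longrightarrow> homog n (P \<cdot> Q)"
  unfolding conc_def by (rule homog_bilin) (auto simp: homog_def)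

text \<open>The two products on pairs of words. The recursion is nested: the inner product
  \<open>gen j \<squnion> (u \<squnion> v)\<close> extends the word-level shuffle bilinearly to the element \<open>u \<squnion> v\<close>. It terminates
  because every word occurring in \<open>u \<squnion> v\<close> has weight the sum of the weights of \<open>u\<close> and \<open>v\<close>, and
  \<open>j < a + b\<close>.\<close>

function (sequential) diamond_word :: "word \<Rightarrow> word \<Rightarrow> 'k::{field,finite} words"
  and shuffle_word :: "word \<Rightarrow> word \<Rightarrow> 'k::{field,finite} words" where
  "diamond_word [] v = basis v"
| "diamond_word u [] = basis u"
| "diamond_word (a # u) (b # v) =
     gen (wt a + wt b) \<cdot> shuffle_word u v
     + (\<Sum>j\<in>{0<..<wt a + wt b}. scale (Delta (wt a) (wt b) j)
          (gen (wt a + wt b - j) \<cdot> bilin shuffle_word (gen j) (shuffle_word u v)))"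
| "shuffle_word [] v = basis v"
| "shuffle_word u [] = basis u"
| "shuffle_word (a # u) (b # v) =
     basis [a] \<cdot> shuffle_word u (b # v) + basis [b] \<cdot> shuffle_word (a # u) v
     + diamond_word (a # u) (b # v)"
  by pat_completeness auto

lemma homog_word_products_partial:
  "diamond_word_shuffle_word_dom TYPE('k::{field,finite}) (Inl (u, v)) \<Longrightarrow>
     homog (word_wt u + word_wt v) (diamond_word u v :: 'k words)"
  "diamond_word_shuffle_word_dom TYPE('k::{field,finite}) (Inr (u', v')) \<Longrightarrow>
     homog (word_wt u' + word_wt v') (shuffle_word u' v' :: 'k words)"
proof (induction u v and u' v' rule: diamond_word_shuffle_word.pinduct)
  case (3 a u b v)
  have inner: "homog (j + (word_wt u + word_wt v)) (bilin shuffle_word (gen j) (shuffle_word u v) :: 'k words)"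
    if "j \<in> {0<..<wt a + wt b}" for j
  proof (rule homog_bilin)
    fix u' v' assume *: "u' \<in> Poly_Mapping.keys (gen j :: 'k words)"
      "v' \<in> Poly_Mapping.keys (shuffle_word u v :: 'k words)"
    with "3.IH"(1) that have "word_wt u' + word_wt v' = j + (word_wt u + word_wt v)"
      by (simp add: homog_def)
    with "3.IH"(3)[OF that *] show "homog (j + (word_wt u + word_wt v)) (shuffle_word u' v' :: 'k words)"
      by simp
  qed
  have "homog (word_wt (a # u) + word_wt (b # v)) (gen (wt a + wt b) \<cdot> shuffle_word u v :: 'k words)"
    by (rule homog_conc[OF homog_basis[OF refl] "3.IH"(1)]) simp
  moreover have "homog (word_wt (a # u) + word_wt (b # v))
      (gen (wt a + wt b - j) \<cdot> bilin shuffle_word (gen j) (shuffle_word u v) :: 'k words)"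
    if "j \<in> {0<..<wt a + wt b}" for j
    by (rule homog_conc[OF homog_basis[OF refl] inner[OF that]]) (use that in simp)
  ultimately show ?case
    unfolding diamond_word.psimps(3)[OF "3.hyps"] by (intro homog_add homog_sum homog_scale)
next
  case (6 a u b v)
  have "homog (word_wt (a # u) + word_wt (b # v)) (basis [a] \<cdot> shuffle_word u (b # v) :: 'k words)"
    by (rule homog_conc[OF homog_basis[OF refl] "6.IH"(1)]) simp
  moreover have "homog (word_wt (a # u) + word_wt (b # v)) (basis [b] \<cdot> shuffle_word (a # u) v :: 'k words)"
    by (rule homog_conc[OF homog_basis[OF refl] "6.IH"(2)]) simp
  ultimately show ?case
    unfolding shuffle_word.psimps(3)[OF "6.hyps"] by (intro homog_add "6.IH"(3))
qed (simp_all add: diamond_word.psimps shuffle_word.psimps homog_basis)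

lemma two_wt_gt: "Suc 0 < 2 * wt a + 2 * wt b"
  using wt_pos[of a] by linarith

termination
proof (relation "measure (case_sum (\<lambda>(u, v). 2 * (word_wt u + word_wt v))
                                   (\<lambda>(u, v). 2 * (word_wt u + word_wt v) + 1))", goal_cases)
  case (4 a u b v j u' v')
  from 4(2) have "u' = [Letter j]"
    by simp
  moreover from 4(3) homog_word_products_partial(2)[OF 4(4)]
  have "word_wt v' = word_wt u + word_wt v"
    unfolding homog_def by blast
  ultimately show ?case
    using 4(1) by simp
qed (auto simp: two_wt_gt)

definition diamond :: "'k::{field,finite} words \<Rightarrow> 'k words \<Rightarrow> 'k words" where
  "diamond = bilin diamond_word"

definition shuffle :: "'k::{field,finite} words \<Rightarrow> 'k words \<Rightarrow> 'k words" where
  "shuffle = bilin shuffle_word"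

lemma scale_one [simp]: "scale 1 P = P"
  by (rule poly_mapping_eqI) simp

lemma bilin_basis [simp]: "bilin f (basis u) (basis v) = f u v"
  unfolding bilin_def by (simp only: keys_basis) (simp add: basis_def)

lemma conc_basis: "basis u \<cdot> basis v = basis (u @ v)"
  by (simp add: conc_def)

lemma product_unit_words:
  "diamond (basis []) (basis v) = basis v" "diamond (basis u) (basis []) = basis u"
  "shuffle (basis []) (basis v) = basis v" "shuffle (basis u) (basis []) = basis u"
  by (simp_all add: diamond_def shuffle_def) (cases u; simp)+

lemma diamond_basis_Cons:
  "diamond (basis (a # u)) (basis (b # v)) =
     gen (wt a + wt b) \<cdot> shuffle (basis u) (basis v)
     + (\<Sum>j\<in>{0<..<wt a + wt b}. scale (Delta (wt a) (wt b) j)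
          (gen (wt a + wt b - j) \<cdot> shuffle (gen j) (shuffle (basis u) (basis v))))"
  by (simp add: diamond_def shuffle_def)

lemma shuffle_basis_Cons:
  "shuffle (basis (a # u)) (basis (b # v)) =
     basis [a] \<cdot> shuffle (basis u) (basis (b # v))
     + basis [b] \<cdot> shuffle (basis (a # u)) (basis v)
     + diamond (basis (a # u)) (basis (b # v))"
  by (simp add: diamond_def shuffle_def)

definition base_field :: "'k::{field,finite} ring" where
  "base_field = \<lparr>carrier = UNIV, mult = (*), one = 1, zero = 0, add = (+)\<rparr>"

definition word_algebra ::
  "('k::{field,finite} words \<Rightarrow> 'k words \<Rightarrow> 'k words) \<Rightarrow> ('k, 'k words) module" where
  "word_algebra m =
     \<lparr>carrier = UNIV, mult = m, one = basis [], zero = 0, add = (+), smult = scale\<rparr>"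

end

theory Submission
  imports Defs "HOL-Computational_Algebra.Formal_Laurent_Series" "HOL-Library.Countable_Set"
begin

text \<open>
  Words are realised as multiple power sums over a generic tower of \<open>\<bbbF>\<^sub>q\<close>-spaces. Choose
  \<open>t\<^sub>0, t\<^sub>1, \<dots>\<close> in the field of Laurent series, put \<open>V\<^sub>d = \<langle>t\<^sub>0, \<dots>, t\<^sub>d\<^sub>-\<^sub>1\<rangle>\<close> and
  \<open>S\<^sub>d(x\<^sub>a u) = (\<Sum>v\<in>V\<^sub>d. (t\<^sub>d + v)\<^sup>-\<^sup>a) S\<^sub><\<^sub>d(u)\<close>, where \<open>S\<^sub><\<^sub>d\<close> is the sum of the \<open>S\<^sub>e\<close> for \<open>e < d\<close>.
  Partial fractions of \<open>1 / (m\<^sup>a n\<^sup>b)\<close> for \<open>m, n \<in> t\<^sub>d + V\<^sub>d\<close> give Chen's formula for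
  \<open>S\<^sub>d(x\<^sub>a) S\<^sub>d(x\<^sub>b)\<close>, whose coefficients are the \<open>\<Delta>\<close>; hence \<open>S\<^sub>d\<close> is multiplicative for the diamond
  product of nonempty words and \<open>S\<^sub><\<^sub>d\<close> for the shuffle product. If every \<open>t\<^sub>d\<close> avoids a
  certain countable set, the pole of \<open>S\<^sub>d(x\<^sub>a)\<close> of order \<open>a\<close> at \<open>t\<^sub>d = 0\<close> shows that the functions \<open>S\<^sub><\<^sub>d\<close>
  together separate the points of the word space, so commutativity and associativity are inherited
  from the field.
\<close>

section \<open>Partial fractions and power sums over cosets\<close>

text \<open>With \<open>X = 1/x\<close>, \<open>Y = 1/y\<close>, \<open>C = 1/(x - y)\<close>, this
  collects the powers of \<open>Y\<close> in the partial fraction expansion of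
  \<open>X ^ Suc a * Y ^ Suc b\<close>. Terms with \<open>k < a\<close> vanish; starting at 0 gives
  both halves of the expansion one index range.\<close>

definition polar_part :: "nat \<Rightarrow> nat \<Rightarrow> 'f::field \<Rightarrow> 'f \<Rightarrow> 'f" where
  "polar_part a b Y C =
     (\<Sum>k\<le>a + b. (-1) ^ (a + k) * of_nat (k choose a) * Y ^ (Suc (a + b) - k) * C ^ Suc k)"

text \<open>Pascal's rule, once the vanishing term \<open>k = 0\<close> is dropped.\<close>

lemma polar_part_Suc_Suc:
  "polar_part (Suc a) (Suc b) Y C =
     C * (polar_part a (Suc b) Y C - polar_part (Suc a) b Y C)"
proof -
  have "polar_part (Suc a) (Suc b) Y C =
      (\<Sum>k\<le>Suc (a + b). (-1) ^ (a + k) * of_nat (Suc k choose Suc a) * Y ^ (Suc (Suc (a + b)) - k) * C ^ Suc (Suc k))"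
    unfolding polar_part_def add_Suc add_Suc_right by (subst sum.atMost_Suc_shift) simp
  also have "\<dots> = C * (polar_part a (Suc b) Y C - polar_part (Suc a) b Y C)"
    unfolding polar_part_def sum_subtractf[symmetric] sum_distrib_left add_Suc add_Suc_right
    by (rule sum.cong) (simp_all add: algebra_simps)
  finally show ?thesis .
qed

text \<open>Here the term \<open>k = 0\<close> survives: it is the pure power of \<open>Y\<close>
  left in \<open>partial_fractions\<close> when the exponent of \<open>X\<close> drops to 0.\<close>

lemma polar_part_0_Suc:
  "polar_part 0 (Suc b) Y C = C * (Y ^ Suc (Suc b) - polar_part 0 b Y C)"
  unfolding polar_part_def add_0
  by (subst sum.atMost_Suc_shift)
     (simp add: algebra_simps sum_distrib_left sum_negf del: sum.atMost_Suc)

lemma polar_part_0_right: "polar_part a 0 Y C = Y * C ^ Suc a"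
proof -
  have "polar_part a 0 Y C =
      (\<Sum>k\<le>a. if k = a then Y * C ^ Suc a else 0)"
    unfolding polar_part_def add_0_right
    by (rule sum.cong) (auto simp: binomial_eq_0 mult_2[symmetric])
  then show ?thesis
    by simp
qed

text \<open>Replacing one factor \<open>X * Y\<close> by \<open>C * (Y - X)\<close> lowers one
  exponent in each summand; the polar parts obey the same recursion.\<close>

lemma partial_fractions:
  fixes X Y C :: "'f::field"
  assumes XY: "X * Y = C * (Y - X)"
  shows "X ^ Suc a * Y ^ Suc b = polar_part a b Y C + polar_part b a X (- C)"
proof (induction "a + b" arbitrary: a b)
  case 0
  then show ?case
    using XY by (simp add: polar_part_0_right algebra_simps)
next
  case (Suc n)
  have step: "X ^ Suc i * Y ^ Suc j = C * (X ^ i * Y ^ Suc j - X ^ Suc i * Y ^ j)" for i j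
  proof -
    have "X ^ Suc i * Y ^ Suc j = (X * Y) * (X ^ i * Y ^ j)"
      by (simp add: algebra_simps)
    then show ?thesis
      unfolding XY by (simp add: algebra_simps)
  qed
  consider b' where "a = 0" "b = Suc b'" | a' where "a = Suc a'" "b = 0"
    | a' b' where "a = Suc a'" "b = Suc b'"
    using Suc(2) by (cases a; cases b) auto
  then show ?case
  proof cases
    case 1
    then have "X ^ Suc 0 * Y ^ Suc b' = polar_part 0 b' Y C + polar_part b' 0 X (- C)"
      using Suc by (intro Suc(1)) auto
    then show ?thesis
      unfolding 1 step[of 0 "Suc b'"] by (simp add: polar_part_0_Suc polar_part_0_right right_diff_distrib distrib_left)
  next
    case 2
    then have "X ^ Suc a' * Y ^ Suc 0 = polar_part a' 0 Y C + polar_part 0 a' X (- C)"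
      using Suc by (intro Suc(1)) auto
    then show ?thesis
      unfolding 2 step[of "Suc a'" 0] by (simp add: polar_part_0_Suc polar_part_0_right right_diff_distrib distrib_left)
  next
    case 3
    then have "X ^ Suc a' * Y ^ Suc b = polar_part a' b Y C + polar_part b a' X (- C)"
      "X ^ Suc a * Y ^ Suc b' = polar_part a b' Y C + polar_part b' a X (- C)"
      using Suc by (intro Suc(1); simp)+
    then show ?thesis
      unfolding 3 by (subst step) (simp add: polar_part_Suc_Suc algebra_simps del: power_Suc)
  qed
qed

text \<open>Clearing denominators and evaluating at \<open>0\<close> isolates the coefficient of the pole of
  largest order at \<open>0\<close>.\<close>

lemma finite_coset_power_sum_relation:
  fixes c :: "nat \<Rightarrow> 'f::field"
  assumes "finite V" "0 \<in> V" "finite A" "0 \<notin> A" "m \<in> A" "c m \<noteq> 0"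
  shows "finite {t. (\<forall>v\<in>V. t + v \<noteq> 0) \<and> (\<Sum>a\<in>A. c a * (\<Sum>v\<in>V. inverse (t + v) ^ a)) = 0}"
    (is "finite ?S")
proof -
  \<comment> \<open>Zero coefficients are discarded so that the maximum \<open>N\<close> is the true
    pole order at \<open>t = 0\<close>.\<close>
  define A' where "A' = {a\<in>A. c a \<noteq> 0}"
  have A': "finite A'" "m \<in> A'"
    using assms by (auto simp: A'_def)
  define N where "N = Max A'"
  have le_N: "a \<le> N" if "a \<in> A'" for a
    using A' by (simp add: N_def that)
  have N: "N \<in> A'"
    unfolding N_def using A' by (intro Max_in) auto
  have "N > 0"
    using N assms(4) by (cases N) (auto simp: A'_def)
  \<comment> \<open>The combination of power sums, multiplied by all \<open>(t + w) ^ N\<close> with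
    \<open>w\<close> in \<open>V\<close>.\<close>
  define p where "p = (\<Sum>a\<in>A'. smult (c a) (\<Sum>v\<in>V. [:v, 1:] ^ (N - a) * (\<Prod>w\<in>V - {v}. [:w, 1:] ^ N)))"
  have eval: "poly p t = (\<Sum>a\<in>A'. c a * (\<Sum>v\<in>V. (t + v) ^ (N - a) * (\<Prod>w\<in>V - {v}. (t + w) ^ N)))" for t
    by (simp add: p_def poly_sum poly_prod add.commute)
  \<comment> \<open>At 0, a summand with \<open>v \<noteq> 0\<close> contains the factor
    \<open>0 ^ N\<close>, and \<open>v = 0\<close> leaves \<open>0 ^ (N - a)\<close>; only
    \<open>v = 0\<close>, \<open>a = N\<close> survives.\<close>
  have "poly p 0 = (\<Sum>a\<in>A'. if a = N then c N * (\<Prod>w\<in>V - {0}. w ^ N) else 0)"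
    unfolding eval
  proof (rule sum.cong[OF refl])
    fix a assume a: "a \<in> A'"
    have "(\<Sum>v\<in>V. (0 + v) ^ (N - a) * (\<Prod>w\<in>V - {v}. (0 + w) ^ N))
        = (\<Sum>v\<in>V. if v = 0 then (if a = N then (\<Prod>w\<in>V - {0}. w ^ N) else 0) else 0)"
    proof (rule sum.cong[OF refl])
      fix v assume "v \<in> V"
      have "(\<Prod>w\<in>V - {v}. w ^ N) = 0" if "v \<noteq> 0"
        using assms(1,2) that \<open>N > 0\<close> by (intro prod_zero bexI[of _ 0]) auto
      then show "(0 + v) ^ (N - a) * (\<Prod>w\<in>V - {v}. (0 + w) ^ N)
          = (if v = 0 then (if a = N then (\<Prod>w\<in>V - {0}. w ^ N) else 0) else 0)"
        using le_N[OF a] by auto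
    qed
    then show "c a * (\<Sum>v\<in>V. (0 + v) ^ (N - a) * (\<Prod>w\<in>V - {v}. (0 + w) ^ N))
        = (if a = N then c N * (\<Prod>w\<in>V - {0}. w ^ N) else 0)"
      using assms(1,2) by simp
  qed
  also have "\<dots> = c N * (\<Prod>w\<in>V - {0}. w ^ N)"
    using A' N by simp
  finally have "poly p 0 \<noteq> 0"
    using N assms(1) by (auto simp: A'_def)
  then have "finite {t. poly p t = 0}"
    by (intro poly_roots_finite) auto
  moreover have "poly p t = 0" if t: "t \<in> ?S" for t
  proof -
    have "(t + v) ^ (N - a) * (\<Prod>w\<in>V - {v}. (t + w) ^ N) = (\<Prod>w\<in>V. (t + w) ^ N) * inverse (t + v) ^ a"
      if "v \<in> V" "a \<in> A'" for a v
      using t that le_N[of a] assms(1)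
      by (simp add: prod.remove[of V v] power_diff_conv_inverse)
    then have "poly p t = (\<Sum>a\<in>A'. c a * (\<Sum>v\<in>V. (\<Prod>w\<in>V. (t + w) ^ N) * inverse (t + v) ^ a))"
      unfolding eval by simp
    also have "\<dots> = (\<Prod>w\<in>V. (t + w) ^ N) * (\<Sum>a\<in>A'. c a * (\<Sum>v\<in>V. inverse (t + v) ^ a))"
      by (simp add: sum_distrib_left mult.left_commute)
    also have "(\<Sum>a\<in>A'. c a * (\<Sum>v\<in>V. inverse (t + v) ^ a)) = (\<Sum>a\<in>A. c a * (\<Sum>v\<in>V. inverse (t + v) ^ a))"
      using assms(3) by (intro sum.mono_neutral_left) (auto simp: A'_def)
    finally show ?thesis
      using t by simp
  qed
  ultimately show ?thesis
    by (intro finite_subset[of ?S "{t. poly p t = 0}"] subsetI CollectI)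
qed

text \<open>The diagonal of the double sum gives \<open>S (a + b)\<close>. Off it, partial fractions
  apply with \<open>C = 1/(v - w)\<close>; for fixed \<open>w\<close> the difference runs through
  \<open>V - {0}\<close>, so the sums over \<open>w\<close> and over the difference
  separate.\<close>

lemma coset_power_sum_mult:
  fixes V :: "'f::field set"
  assumes V: "finite V" "\<And>x y. x \<in> V \<Longrightarrow> y \<in> V \<Longrightarrow> x + y \<in> V" "\<And>x y. x \<in> V \<Longrightarrow> y \<in> V \<Longrightarrow> x - y \<in> V"
    and t: "\<And>v. v \<in> V \<Longrightarrow> t + v \<noteq> 0"
    and "0 < a" "0 < b"
  defines "S \<equiv> \<lambda>i. \<Sum>v\<in>V. inverse (t + v) ^ i"
  shows "S a * S b = S (a + b) + (\<Sum>j\<in>{0<..<a + b}.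
     (-1) ^ (j - 1) * ((-1) ^ (a - 1) * of_nat ((j - 1) choose (a - 1))
       + (-1) ^ (b - 1) * of_nat ((j - 1) choose (b - 1)))
       * S (a + b - j) * (\<Sum>v\<in>V - {0}. inverse v ^ j))"
proof -
  obtain \<alpha> \<beta> where ab: "a = Suc \<alpha>" "b = Suc \<beta>"
    using assms(5,6) by (cases a; cases b) auto
  define T where "T = (\<lambda>a b. \<Sum>w\<in>V. \<Sum>c\<in>V - {0}. polar_part a b (inverse (t + w)) (inverse c))"
  have T_shift: "T i j = (\<Sum>w\<in>V. \<Sum>v\<in>V - {w}. polar_part i j (inverse (t + w)) (inverse (v - w)))" for i j
    unfolding T_def
  proof (rule sum.cong[OF refl])
    fix w assume "w \<in> V"
    then show "(\<Sum>c\<in>V - {0}. polar_part i j (inverse (t + w)) (inverse c))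
        = (\<Sum>v\<in>V - {w}. polar_part i j (inverse (t + w)) (inverse (v - w)))"
      using V by (intro sum.reindex_bij_witness[of _ "\<lambda>v. v - w" "\<lambda>c. c + w"]) auto
  qed
  have T_eq: "T i j = (\<Sum>k\<le>i + j. (-1) ^ (i + k) * of_nat (k choose i) * S (Suc (i + j) - k)
      * (\<Sum>v\<in>V - {0}. inverse v ^ Suc k))" for i j
  proof -
    have "T i j = (\<Sum>w\<in>V. \<Sum>k\<le>i + j. \<Sum>c\<in>V - {0}. (-1) ^ (i + k) * of_nat (k choose i)
        * inverse (t + w) ^ (Suc (i + j) - k) * inverse c ^ Suc k)"
      unfolding T_def polar_part_def by (intro sum.cong[OF refl] sum.swap)
    also have "\<dots> = (\<Sum>k\<le>i + j. \<Sum>w\<in>V. \<Sum>c\<in>V - {0}. (-1) ^ (i + k) * of_nat (k choose i)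
        * inverse (t + w) ^ (Suc (i + j) - k) * inverse c ^ Suc k)"
      by (rule sum.swap)
    finally show ?thesis
      unfolding S_def by (simp only: mult.assoc sum_product) (simp only: sum_distrib_left)
  qed
  have pf: "inverse (t + v) ^ a * inverse (t + w) ^ b
      = polar_part \<alpha> \<beta> (inverse (t + w)) (inverse (v - w)) + polar_part \<beta> \<alpha> (inverse (t + v)) (inverse (w - v))"
    if "v \<in> V" "w \<in> V - {v}" for v w
  proof -
    have "inverse (t + v) * inverse (t + w) = inverse (v - w) * (inverse (t + w) - inverse (t + v))"
    proof -
      have "inverse (t + w) - inverse (t + v) = (v - w) * (inverse (t + v) * inverse (t + w))"
        using that t[of v] t[of w] by (simp add: field_simps)
      moreover have "inverse (v - w) * (v - w) = 1"
        using that by (intro left_inverse) auto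
      ultimately show ?thesis
        by (simp add: mult.assoc[symmetric])
    qed
    from partial_fractions[OF this, of \<alpha> \<beta>] show ?thesis
      unfolding ab using inverse_minus_eq[of "v - w"] by (simp del: inverse_minus_eq)
  qed
  have "S a * S b = (\<Sum>v\<in>V. \<Sum>w\<in>V. inverse (t + v) ^ a * inverse (t + w) ^ b)"
    unfolding S_def by (rule sum_product)
  also have "\<dots> = (\<Sum>v\<in>V. inverse (t + v) ^ (a + b) + (\<Sum>w\<in>V - {v}. inverse (t + v) ^ a * inverse (t + w) ^ b))"
    using V(1) by (intro sum.cong[OF refl]) (simp add: sum.remove power_add)
  also have "\<dots> = S (a + b) + (\<Sum>v\<in>V. \<Sum>w\<in>V - {v}. inverse (t + v) ^ a * inverse (t + w) ^ b)"
    unfolding S_def by (rule sum.distrib)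
  also have "(\<Sum>v\<in>V. \<Sum>w\<in>V - {v}. inverse (t + v) ^ a * inverse (t + w) ^ b)
      = (\<Sum>v\<in>V. \<Sum>w\<in>V - {v}. polar_part \<alpha> \<beta> (inverse (t + w)) (inverse (v - w))) + T \<beta> \<alpha>"
    unfolding T_shift sum.distrib[symmetric] by (intro sum.cong[OF refl] pf)
  also have "(\<Sum>v\<in>V. \<Sum>w\<in>V - {v}. polar_part \<alpha> \<beta> (inverse (t + w)) (inverse (v - w))) = T \<alpha> \<beta>"
    unfolding T_shift sum.Sigma[OF V(1) ballI[OF finite_Diff[OF V(1)]]]
    by (intro sum.reindex_bij_witness[of _ prod.swap prod.swap]) auto
  also have "T \<alpha> \<beta> + T \<beta> \<alpha> = (\<Sum>k\<le>\<alpha> + \<beta>. (-1) ^ k * ((-1) ^ \<alpha> * of_nat (k choose \<alpha>)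
       + (-1) ^ \<beta> * of_nat (k choose \<beta>)) * S (Suc (\<alpha> + \<beta>) - k) * (\<Sum>v\<in>V - {0}. inverse v ^ Suc k))"
    unfolding T_eq add.commute[of \<beta> \<alpha>] sum.distrib[symmetric]
    by (intro sum.cong[OF refl]) (simp add: power_add algebra_simps del: power_Suc)
  also have "\<dots> = (\<Sum>j\<in>{0<..<a + b}.
     (-1) ^ (j - 1) * ((-1) ^ (a - 1) * of_nat ((j - 1) choose (a - 1))
       + (-1) ^ (b - 1) * of_nat ((j - 1) choose (b - 1)))
       * S (a + b - j) * (\<Sum>v\<in>V - {0}. inverse v ^ j))"
    unfolding ab
    by (intro sum.reindex_bij_witness[of _ "\<lambda>j. j - 1" Suc]) (auto simp del: power_Suc)
  finally show ?thesis .
qed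

section \<open>Power sums over a finite field\<close>

lemma finite_field_power_card_minus_1:
  fixes x :: "'k::{field,finite}"
  assumes "x \<noteq> 0"
  shows "x ^ (CARD('k) - 1) = 1"
proof -
  have "(\<Prod>y\<in>UNIV - {0}. x * y) = (\<Prod>y\<in>UNIV - {0::'k}. y)"
    using assms by (intro prod.reindex_bij_witness[of _ "\<lambda>y. y / x" "\<lambda>y. x * y"]) auto
  then have "x ^ (CARD('k) - 1) * (\<Prod>y\<in>UNIV - {0::'k}. y) = (\<Prod>y\<in>UNIV - {0::'k}. y)"
    by (simp add: prod.distrib card_Diff_singleton)
  moreover have "(\<Prod>y\<in>UNIV - {0::'k}. y) \<noteq> 0"
    by simp
  ultimately show ?thesis
    by (metis mult_cancel_right1)
qed

lemma finite_field_of_nat_card: "of_nat CARD('k) = (0 :: 'k::{field,finite})"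
proof -
  have "(\<Sum>x\<in>UNIV. x + 1) = (\<Sum>x\<in>UNIV. x :: 'k)"
    by (intro sum.reindex_bij_witness[of _ "\<lambda>y. y - 1" "\<lambda>y. y + 1"]) auto
  then show ?thesis
    by (simp add: sum.distrib)
qed

text \<open>If \<open>CARD('k) - 1\<close> divides \<open>j\<close>, every summand is 1. Otherwise
  some unit \<open>y\<close> has \<open>y ^ j \<noteq> 1\<close>, and rescaling by \<open>y\<close>
  shows that the sum equals \<open>y ^ j\<close> times itself.\<close>

lemma sum_units_inverse_power:
  "(\<Sum>x\<in>UNIV - {0}. inverse x ^ j) = (if (CARD('k) - 1) dvd j then -1 else (0 :: 'k::{field,finite}))"
proof (cases "(CARD('k) - 1) dvd j")
  case True
  then obtain m where "j = (CARD('k) - 1) * m"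
    by blast
  then have "inverse x ^ j = 1" if "x \<noteq> 0" for x :: 'k
    using that finite_field_power_card_minus_1[of "inverse x"] by (simp add: power_mult)
  then have "(\<Sum>x\<in>UNIV - {0}. inverse x ^ j) = (of_nat (CARD('k) - 1) :: 'k)"
    by (simp add: card_Diff_singleton)
  also have "\<dots> = of_nat CARD('k) - 1"
    by (simp add: of_nat_diff Suc_leI)
  finally show ?thesis
    using True by (simp add: finite_field_of_nat_card)
next
  case False
  define n where "n = CARD('k) - 1"
  define r where "r = j mod n"
  have n: "n > 0"
    using card_mono[of UNIV "{0, 1::'k}"] by (simp add: n_def)
  have r: "0 < r" "r < n"
    using False n by (auto simp: r_def n_def mod_eq_0_iff_dvd intro!: Nat.gr0I)
  have pow: "x ^ j = x ^ r" if "x \<noteq> 0" for x :: 'k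
  proof -
    have "x ^ j = (x ^ n) ^ (j div n) * x ^ r"
      unfolding r_def by (metis div_mult_mod_eq mult.commute power_add power_mult)
    then show ?thesis
      using finite_field_power_card_minus_1[OF that] by (simp add: n_def)
  qed
  \<comment> \<open>Otherwise all units would be roots of \<open>monom 1 r - 1\<close>, whose degree
    is too small.\<close>
  have "\<exists>y::'k. y \<noteq> 0 \<and> y ^ j \<noteq> 1"
  proof (rule ccontr)
    assume *: "\<nexists>y::'k. y \<noteq> 0 \<and> y ^ j \<noteq> 1"
    let ?p = "monom 1 r - 1 :: 'k poly"
    have deg: "degree ?p \<le> r"
      by (intro degree_diff_le degree_monom_le) simp
    have nz: "?p \<noteq> 0"
    proof
      assume "?p = 0"
      then have "coeff ?p r = 0"
        by simp
      then show False
        using r by (simp add: coeff_diff)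
    qed
    have "UNIV - {0::'k} \<subseteq> {x. poly ?p x = 0}"
      using * pow by (auto simp: poly_monom)
    then have "card (UNIV - {0::'k}) \<le> r"
      using card_mono[OF poly_roots_finite[OF nz]] card_poly_roots_bound[OF nz] deg
      by (meson le_trans)
    then show False
      using r by (simp add: n_def card_Diff_singleton)
  qed
  then obtain y :: 'k where y: "y \<noteq> 0" "y ^ j \<noteq> 1"
    by blast
  have "(\<Sum>x\<in>UNIV - {0}. inverse x ^ j) = (\<Sum>x\<in>UNIV - {0::'k}. y ^ j * inverse x ^ j)"
    using y by (intro sum.reindex_bij_witness[of _ "\<lambda>x. x / y" "\<lambda>x. y * x"])
      (auto simp: power_mult_distrib field_simps)
  then have "(1 - y ^ j) * (\<Sum>x\<in>UNIV - {0}. inverse x ^ j) = (0::'k)"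
    by (simp add: sum_distrib_left[symmetric] algebra_simps)
  then show ?thesis
    using y False by simp
qed

section \<open>Linear functionals on the word space\<close>

text \<open>The values lie in Laurent series because the generic choice of the tower uses an
  uncountable field containing \<open>'k\<close>.\<close>

definition lin_ext :: "(word \<Rightarrow> 'k::{field,finite} fls) \<Rightarrow> 'k words \<Rightarrow> 'k fls" where
  "lin_ext f P = (\<Sum>w\<in>Poly_Mapping.keys P. fls_const (Poly_Mapping.lookup P w) * f w)"

lemma lin_ext_superset:
  assumes "finite A" "Poly_Mapping.keys P \<subseteq> A"
  shows "lin_ext f P = (\<Sum>w\<in>A. fls_const (Poly_Mapping.lookup P w) * f w)"
  unfolding lin_ext_def using assms by (intro sum.mono_neutral_left) (auto simp: in_keys_iff)

lemma lin_ext_zero [simp]: "lin_ext f 0 = 0"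
  by (simp add: lin_ext_def)

lemma lin_ext_basis [simp]: "lin_ext f (basis u) = f u"
  unfolding lin_ext_def by (simp only: keys_basis) (simp add: basis_def)

lemma lin_ext_add: "lin_ext f (P + Q) = lin_ext f P + lin_ext f Q"
proof -
  let ?A = "Poly_Mapping.keys P \<union> Poly_Mapping.keys Q"
  have "lin_ext f (P + Q) = (\<Sum>w\<in>?A. fls_const (Poly_Mapping.lookup (P + Q) w) * f w)"
    using Poly_Mapping.keys_add[of P Q] by (intro lin_ext_superset) auto
  also have "\<dots> = (\<Sum>w\<in>?A. fls_const (Poly_Mapping.lookup P w) * f w)
      + (\<Sum>w\<in>?A. fls_const (Poly_Mapping.lookup Q w) * f w)"
    by (simp add: lookup_add fls_plus_const[symmetric] distrib_right sum.distrib)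
  also have "\<dots> = lin_ext f P + lin_ext f Q"
    by (simp add: lin_ext_superset[symmetric])
  finally show ?thesis .
qed

lemma lin_ext_diff: "lin_ext f (P - Q) = lin_ext f P - lin_ext f Q"
  using lin_ext_add[of f "P - Q" Q] by simp

lemma lin_ext_scale: "lin_ext f (scale c P) = fls_const c * lin_ext f P"
proof -
  have "lin_ext f (scale c P) = (\<Sum>w\<in>Poly_Mapping.keys P. fls_const (Poly_Mapping.lookup (scale c P) w) * f w)"
    by (intro lin_ext_superset keys_scale) simp
  then show ?thesis
    by (simp add: lin_ext_def sum_distrib_left fls_const_mult_const[symmetric] mult.assoc del: fls_const_mult_const)
qed

lemma lin_ext_sum: "lin_ext f (sum g I) = (\<Sum>i\<in>I. lin_ext f (g i))"
  by (induction I rule: infinite_finite_induct) (simp_all add: lin_ext_add)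

lemma lin_ext_fun_add: "lin_ext (\<lambda>w. f w + g w) P = lin_ext f P + lin_ext g P"
  by (simp add: lin_ext_def distrib_left sum.distrib)

lemma lin_ext_bilin:
  assumes "\<And>u v. u \<in> Poly_Mapping.keys P \<Longrightarrow> v \<in> Poly_Mapping.keys Q \<Longrightarrow> lin_ext f (g u v) = h u * k v"
  shows "lin_ext f (bilin g P Q) = lin_ext h P * lin_ext k Q"
proof -
  have "lin_ext f (bilin g P Q) = (\<Sum>u\<in>Poly_Mapping.keys P. \<Sum>v\<in>Poly_Mapping.keys Q.
      (fls_const (Poly_Mapping.lookup P u) * h u) * (fls_const (Poly_Mapping.lookup Q v) * k v))"
    unfolding bilin_def lin_ext_sum lin_ext_scale
    by (intro sum.cong[OF refl])
      (simp add: assms fls_const_mult_const[symmetric] algebra_simps del: fls_const_mult_const)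
  then show ?thesis
    by (simp add: lin_ext_def sum_product)
qed

lemma lin_ext_conc_letter:
  assumes "\<And>u. f (a # u) = c * k u"
  shows "lin_ext f (basis [a] \<cdot> P) = c * lin_ext k P"
proof -
  have "lin_ext f (basis [a] \<cdot> P) = lin_ext (\<lambda>_. c) (basis [a]) * lin_ext k P"
    unfolding conc_def by (rule lin_ext_bilin) (simp add: assms)
  then show ?thesis
    by simp
qed

lemma cring_base_field: "cring (base_field :: 'k::{field,finite} ring)"
  unfolding base_field_def
  by (intro cringI abelian_groupI comm_monoidI)
    (auto simp: algebra_simps intro: exI[of _ "- _"])

text \<open>A product on words is determined by any separating family of multiplicative functionals,
  so all its laws may be checked in the field of Laurent series.\<close>

lemma algebra_if_separating_characters:
  fixes g :: "word \<Rightarrow> word \<Rightarrow> 'k::{field,finite} words" and \<chi> :: "'i \<Rightarrow> word \<Rightarrow> 'k fls"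
  assumes unit: "\<And>i. \<chi> i [] = 1"
    and mult: "\<And>i u v. lin_ext (\<chi> i) (g u v) = \<chi> i u * \<chi> i v"
    and separating: "\<And>P. (\<And>i. lin_ext (\<chi> i) P = 0) \<Longrightarrow> P = 0"
  shows "algebra (base_field :: 'k ring) (word_algebra (bilin g))"
proof -
  have eqI: "P = Q" if "\<And>i. lin_ext (\<chi> i) P = lin_ext (\<chi> i) Q" for P Q
    using separating[of "P - Q"] that by (simp add: lin_ext_diff)
  have lin_ext_mult: "lin_ext (\<chi> i) (bilin g P Q) = lin_ext (\<chi> i) P * lin_ext (\<chi> i) Q" for i P Q
    by (rule lin_ext_bilin) (rule mult)
  note laws = lin_ext_mult lin_ext_add lin_ext_scale unit
  have "abelian_group (word_algebra (bilin g))"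
    unfolding word_algebra_def
    by (rule abelian_groupI) (auto simp: algebra_simps intro: exI[of _ "- _"])
  moreover have "comm_monoid (word_algebra (bilin g))"
    unfolding word_algebra_def
    by (rule comm_monoidI) (auto intro!: eqI simp: laws algebra_simps)
  ultimately have "cring (word_algebra (bilin g))"
    by (rule cringI) (auto intro!: eqI simp: word_algebra_def laws algebra_simps)
  then show ?thesis
    by (intro algebraI cring_base_field)
      (auto intro!: eqI simp: word_algebra_def base_field_def laws algebra_simps
         fls_plus_const[symmetric] fls_const_mult_const[symmetric] simp del: fls_const_mult_const)
qed

section \<open>Generic towers\<close>

instance letter :: countable
  by (rule countable_classI[of wt]) (simp add: wt_inject)

text \<open>An element is determined by its graph over its support, a finite subset of a countable
  set.\<close>

lemma countable_words: "countable (UNIV :: 'k::{field,finite} words set)"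
proof -
  define graph where "graph = (\<lambda>P :: 'k words. (\<lambda>u. (u, Poly_Mapping.lookup P u)) ` Poly_Mapping.keys P)"
  have "inj graph"
  proof (rule injI, rule poly_mapping_eqI)
    fix P Q :: "'k words" and u assume *: "graph P = graph Q"
    have "(u, c) \<in> graph P \<longleftrightarrow> c \<noteq> 0 \<and> Poly_Mapping.lookup P u = c" for c and P :: "'k words"
      by (auto simp: graph_def in_keys_iff)
    with * show "Poly_Mapping.lookup P u = Poly_Mapping.lookup Q u"
      by metis
  qed
  moreover have "countable (range graph)"
    by (rule countable_subset[OF _ countable_Collect_finite]) (auto simp: graph_def)
  ultimately show ?thesis
    by (auto dest: countable_image_inj_on)
qed

lemma uncountable_fls: "uncountable (UNIV :: 'k::field fls set)"
proof
  assume "countable (UNIV :: 'k fls set)"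
  define F where "F = (\<lambda>A :: nat set. fps_to_fls (Abs_fps (\<lambda>n. if n \<in> A then 1 else (0::'k))))"
  have "inj F"
    by (auto simp: inj_def F_def fps_eq_iff split: if_splits)
  moreover have "countable (range F)"
    by (rule countable_subset[OF subset_UNIV]) fact
  ultimately have "countable (UNIV :: nat set set)"
    by (auto dest: countable_image_inj_on)
  then obtain h :: "nat set \<Rightarrow> nat" where "inj h"
    by (auto simp: countable_def)
  then have "surj (inv_into UNIV h)"
    by (rule inj_imp_surj_inv)
  then show False
    using Cantors_theorem[of "UNIV :: nat set"] by auto
qed

text \<open>For \<open>V = V\<^sub>d\<close>, \<open>t = t\<^sub>d\<close> and \<open>s = S\<^sub><\<^sub>d\<close> this is \<open>S\<^sub>d\<close>.\<close>

definition layer :: "'k::{field,finite} fls set \<Rightarrow> 'k fls \<Rightarrow> (word \<Rightarrow> 'k fls) \<Rightarrow> word \<Rightarrow> 'k fls" where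
  "layer V t s w = (case w of [] \<Rightarrow> 0 | a # u \<Rightarrow> (\<Sum>v\<in>V. inverse (t + v) ^ wt a) * s u)"

lemma layer_simps [simp]:
  "layer V t s [] = 0"
  "layer V t s (a # u) = (\<Sum>v\<in>V. inverse (t + v) ^ wt a) * s u"
  by (simp_all add: layer_def)

text \<open>\<open>Poly_Mapping.map_key ((#) a) P\<close> is the left quotient of \<open>P\<close>
  by the letter \<open>a\<close>. The second clause lets a relation satisfied by the layer be
  stripped of its first letter, which later separates points.\<close>

definition generic :: "'k::{field,finite} fls set \<Rightarrow> (word \<Rightarrow> 'k fls) \<Rightarrow> 'k fls \<Rightarrow> bool" where
  "generic V s t \<longleftrightarrow> t \<notin> V \<and> (\<forall>P. lin_ext (layer V t s) P = 0 \<longrightarrow>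
     (\<forall>a. lin_ext s (Poly_Mapping.map_key ((#) a) P) = 0))"

text \<open>Grouping by first letters gives a combination of power sums with coefficients
  independent of \<open>t\<close>, the form that \<open>finite_coset_power_sum_relation\<close>
  takes.\<close>

lemma lin_ext_layer:
  "lin_ext (layer V t s) P = (\<Sum>n\<in>{wt a |a u. a # u \<in> Poly_Mapping.keys P}.
     lin_ext s (Poly_Mapping.map_key ((#) (Letter n)) P) * (\<Sum>v\<in>V. inverse (t + v) ^ n))"
proof -
  define A where "A = {a. \<exists>u. a # u \<in> Poly_Mapping.keys P}"
  have "A \<subseteq> hd ` Poly_Mapping.keys P"
    by (force simp: A_def)
  then have fin: "finite A"
    by (rule finite_subset) simp
  have keys: "Poly_Mapping.keys (Poly_Mapping.map_key ((#) a) P) = (#) a -` Poly_Mapping.keys P" for a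
    by (simp add: keys_map_key)
  have finv: "finite ((#) a -` Poly_Mapping.keys P)" for a
    by (intro finite_vimageI) auto
  have "lin_ext (layer V t s) P = (\<Sum>w\<in>Poly_Mapping.keys P - {[]}. fls_const (Poly_Mapping.lookup P w) * layer V t s w)"
    unfolding lin_ext_def by (intro sum.mono_neutral_right) auto
  also have "\<dots> = (\<Sum>(a, u)\<in>(SIGMA a:A. (#) a -` Poly_Mapping.keys P).
      fls_const (Poly_Mapping.lookup P (a # u)) * layer V t s (a # u))"
    by (intro sum.reindex_bij_witness[of _ "\<lambda>(a, u). a # u" "\<lambda>w. (hd w, tl w)"]) (auto simp: A_def neq_Nil_conv)
  also have "\<dots> = (\<Sum>a\<in>A. \<Sum>u\<in>(#) a -` Poly_Mapping.keys P.
      fls_const (Poly_Mapping.lookup P (a # u)) * layer V t s (a # u))"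
    using fin finv by (subst sum.Sigma) auto
  also have "\<dots> = (\<Sum>a\<in>A. lin_ext s (Poly_Mapping.map_key ((#) a) P) * (\<Sum>v\<in>V. inverse (t + v) ^ wt a))"
    by (simp add: lin_ext_def keys map_key.rep_eq sum_distrib_left[where A = "_ -` _"] mult_ac)
  also have "\<dots> = (\<Sum>n\<in>wt ` A. lin_ext s (Poly_Mapping.map_key ((#) (Letter n)) P) * (\<Sum>v\<in>V. inverse (t + v) ^ n))"
    by (subst sum.reindex) (auto simp: inj_on_def wt_inject wt_inverse)
  also have "wt ` A = {wt a |a u. a # u \<in> Poly_Mapping.keys P}"
    by (auto simp: A_def)
  finally show ?thesis .
qed

text \<open>Each \<open>P\<close> excludes only finitely many \<open>t\<close> outside
  \<open>V\<close>; there are countably many \<open>P\<close>, and the field is uncountable.\<close>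

lemma ex_generic:
  fixes V :: "'k::{field,finite} fls set"
  assumes "finite V" "0 \<in> V" "\<And>x. x \<in> V \<Longrightarrow> - x \<in> V"
  shows "\<exists>t. generic V s t"
proof -
  define bad where "bad = (\<lambda>P. {t. (\<forall>v\<in>V. t + v \<noteq> 0) \<and> lin_ext (layer V t s) P = 0
      \<and> (\<exists>a. lin_ext s (Poly_Mapping.map_key ((#) a) P) \<noteq> 0)})"
  have "finite (bad P)" for P
  proof (cases "\<exists>a. lin_ext s (Poly_Mapping.map_key ((#) a) P) \<noteq> 0")
    case True
    then obtain a where a: "lin_ext s (Poly_Mapping.map_key ((#) a) P) \<noteq> 0"
      by blast
    let ?A = "{wt a |a u. a # u \<in> Poly_Mapping.keys P}"
    have "?A \<subseteq> (wt \<circ> hd) ` Poly_Mapping.keys P"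
      by force
    then have "finite ?A"
      by (rule finite_subset) simp
    moreover have "wt a \<in> ?A"
    proof (rule ccontr)
      assume "wt a \<notin> ?A"
      then have "Poly_Mapping.map_key ((#) a) P = 0"
        by (intro poly_mapping_eqI) (auto simp: map_key.rep_eq in_keys_iff)
      with a show False
        by simp
    qed
    moreover have "0 \<notin> ?A"
      by (auto simp: less_imp_neq[OF wt_pos])
    ultimately have "finite {t. (\<forall>v\<in>V. t + v \<noteq> 0) \<and> lin_ext (layer V t s) P = 0}"
      unfolding lin_ext_layer using assms a
      by (intro finite_coset_power_sum_relation[of _ _ "wt a"]) (auto simp: wt_inverse)
    then show ?thesis
      by (rule rev_finite_subset) (auto simp: bad_def)
  qed (simp add: bad_def)
  then have "countable (V \<union> (\<Union>P. bad P))"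
    using assms(1) by (intro countable_Un countable_UN countable_words) (auto intro: countable_finite)
  then obtain t where t: "t \<notin> V \<union> (\<Union>P. bad P)"
    using uncountable_fls by (metis UNIV_eq_I)
  \<comment> \<open>Closure of \<open>V\<close> under negation turns \<open>t \<notin> V\<close>
    into nonzero denominators, the side condition in \<open>bad\<close>.\<close>
  then have "t + v \<noteq> 0" if "v \<in> V" for v
    using assms(3)[OF that] by (auto simp: add_eq_0_iff2)
  with t have "generic V s t"
    by (auto simp: generic_def bad_def)
  then show ?thesis ..
qed

text \<open>The invariant satisfied by \<open>V = V\<^sub>d\<close> and \<open>s = S\<^sub><\<^sub>d\<close>. As \<open>inverse 0 = 0\<close>, the vector \<open>v = 0\<close> does not
  contribute to the power sum.\<close>

definition stage :: "'k::{field,finite} fls set \<Rightarrow> (word \<Rightarrow> 'k fls) \<Rightarrow> bool" where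
  "stage V s \<longleftrightarrow> finite V \<and> 0 \<in> V \<and> (\<forall>x\<in>V. \<forall>y\<in>V. x + y \<in> V) \<and> (\<forall>c. \<forall>x\<in>V. fls_const c * x \<in> V)
     \<and> s [] = 1
     \<and> (\<forall>j>0. (\<Sum>v\<in>V. inverse v ^ j) = - (if (CARD('k) - 1) dvd j then s [Letter j] else 0))
     \<and> (\<forall>u v. lin_ext s (shuffle_word u v) = s u * s v)"

lemma stage_uminus: "stage V s \<Longrightarrow> x \<in> V \<Longrightarrow> - x \<in> V"
  unfolding stage_def by (metis fls_const_1 fls_const_uminus mult_minus1)

lemma stage_minus: "stage V s \<Longrightarrow> x \<in> V \<Longrightarrow> y \<in> V \<Longrightarrow> x - y \<in> V"
  using stage_uminus[of V s y] unfolding stage_def by (metis add_uminus_conv_diff)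

lemma fls_const_Delta:
  "fls_const (Delta a b j :: 'k::{field,finite}) =
     (if (CARD('k) - 1) dvd j \<and> 0 < j \<and> j < a + b
      then (-1) ^ (a - 1) * of_nat ((j - 1) choose (a - 1)) + (-1) ^ (b - 1) * of_nat ((j - 1) choose (b - 1))
      else 0)"
  by (simp add: Delta_def fls_of_nat fls_plus_const[symmetric] fls_const_mult_const[symmetric]
      fls_const_power del: fls_const_mult_const)

lemma minus_one_power_eq_1:
  assumes "(CARD('k::{field,finite}) - 1) dvd j"
  shows "(-1 :: 'k fls) ^ j = 1"
proof -
  obtain m where "j = (CARD('k) - 1) * m"
    using assms by blast
  then have "(-1 :: 'k) ^ j = 1"
    using finite_field_power_card_minus_1[of "-1 :: 'k"] by (simp add: power_mult)
  then have "fls_const ((-1 :: 'k) ^ j) = 1"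
    by simp
  then show ?thesis
    by (simp add: fls_const_power)
qed

text \<open>Chen's formula. The sign \<open>(-1)\<^sup>j\<close> disappears because it is \<open>1\<close> whenever \<open>(q - 1) dvd j\<close>.\<close>

lemma stage_power_sum_mult:
  fixes V :: "'k::{field,finite} fls set"
  assumes st: "stage V s" and t: "t \<notin> V" and ab: "0 < a" "0 < b"
  defines "S \<equiv> \<lambda>i. \<Sum>v\<in>V. inverse (t + v) ^ i"
  shows "S a * S b = S (a + b) +
    (\<Sum>j\<in>{0<..<a + b}. fls_const (Delta a b j) * (S (a + b - j) * s [Letter j]))"
proof -
  have nz: "t + v \<noteq> 0" if "v \<in> V" for v
    using stage_uminus[OF st that] t by (auto simp: add_eq_0_iff2)
  have "S a * S b = S (a + b) + (\<Sum>j\<in>{0<..<a + b}.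
     (-1) ^ (j - 1) * ((-1) ^ (a - 1) * of_nat ((j - 1) choose (a - 1))
       + (-1) ^ (b - 1) * of_nat ((j - 1) choose (b - 1)))
       * S (a + b - j) * (\<Sum>v\<in>V - {0}. inverse v ^ j))"
    unfolding S_def using st nz ab
    by (intro coset_power_sum_mult) (auto simp: stage_def stage_minus[OF st])
  also have "\<dots> = S (a + b) +
      (\<Sum>j\<in>{0<..<a + b}. fls_const (Delta a b j) * (S (a + b - j) * s [Letter j]))"
  proof (intro arg_cong2[where f = "(+)"] refl sum.cong)
    fix j assume j: "j \<in> {0<..<a + b}"
    have "(\<Sum>v\<in>V - {0}. inverse v ^ j) = (\<Sum>v\<in>V. inverse v ^ j)"
      using st j by (intro sum.mono_neutral_left) (auto simp: stage_def)
    also have "\<dots> = - (if (CARD('k) - 1) dvd j then s [Letter j] else 0)"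
      using st j by (simp add: stage_def)
    finally have *: "(\<Sum>v\<in>V - {0}. inverse v ^ j) = - (if (CARD('k) - 1) dvd j then s [Letter j] else 0)" .
    \<comment> \<open>This sign cancels the minus in the power sum clause of
      \<open>stage\<close>.\<close>
    have "(-1 :: 'k fls) ^ (j - 1) = - 1" if "(CARD('k) - 1) dvd j"
      using minus_one_power_eq_1[OF that] j by (cases j) (auto simp: minus_equation_iff)
    then show "(-1) ^ (j - 1) * ((-1) ^ (a - 1) * of_nat ((j - 1) choose (a - 1))
       + (-1) ^ (b - 1) * of_nat ((j - 1) choose (b - 1)))
       * S (a + b - j) * (\<Sum>v\<in>V - {0}. inverse v ^ j) = fls_const (Delta a b j) * (S (a + b - j) * s [Letter j])"
      unfolding * fls_const_Delta using j by (simp add: mult.assoc)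
  qed
  finally show ?thesis .
qed

lemma stage_ext_bilin_shuffle:
  "stage V s \<Longrightarrow> lin_ext s (bilin shuffle_word P Q) = lin_ext s P * lin_ext s Q"
  by (rule lin_ext_bilin) (simp add: stage_def)

text \<open>Chen's formula handles the two first letters; multiplicativity of \<open>s\<close> for
  the shuffle product handles the tails and the inserted \<open>Letter j\<close>.\<close>

lemma layer_diamond_word:
  assumes st: "stage V s" and t: "t \<notin> V"
  shows "lin_ext (layer V t s) (diamond_word (a # u) (b # v)) = layer V t s (a # u) * layer V t s (b # v)"
proof -
  define S where "S = (\<lambda>i. \<Sum>v\<in>V. inverse (t + v) ^ i)"
  have gen: "lin_ext (layer V t s) (gen n \<cdot> P) = S n * lin_ext s P" if "n > 0" for n P
    using that by (intro lin_ext_conc_letter) (simp add: S_def)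
  have sh: "lin_ext s (shuffle_word u v) = s u * s v"
    using st by (simp add: stage_def)
  have "lin_ext (layer V t s) (diamond_word (a # u) (b # v)) = S (wt a + wt b) * (s u * s v)
      + (\<Sum>j\<in>{0<..<wt a + wt b}. fls_const (Delta (wt a) (wt b) j)
          * (S (wt a + wt b - j) * (s [Letter j] * (s u * s v))))"
    by (simp add: lin_ext_add lin_ext_sum lin_ext_scale gen sh stage_ext_bilin_shuffle[OF st])
  also have "\<dots> = (S (wt a + wt b)
      + (\<Sum>j\<in>{0<..<wt a + wt b}. fls_const (Delta (wt a) (wt b) j)
          * (S (wt a + wt b - j) * s [Letter j]))) * (s u * s v)"
    by (simp add: distrib_right sum_distrib_right mult.assoc)
  also have "\<dots> = S (wt a) * S (wt b) * (s u * s v)"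
    using stage_power_sum_mult[OF st t, of "wt a" "wt b"] by (simp add: S_def)
  finally show ?thesis
    by (simp add: S_def mult_ac)
qed

text \<open>The new space is the disjoint union of the cosets \<open>c * t + V\<close>. For
  \<open>c \<noteq> 0\<close>, scaling gives \<open>inverse c ^ j\<close> times the power sum over
  \<open>t + V\<close>. By \<open>sum_units_inverse_power\<close> these add up to minus the
  increment of \<open>s\<close> at \<open>[Letter j]\<close> if \<open>(CARD('k) - 1) dvd j\<close>,
  and to 0 otherwise.\<close>

lemma stage_step:
  fixes V :: "'k::{field,finite} fls set"
  assumes st: "stage V s" and t: "t \<notin> V"
  shows "stage ((\<lambda>(c, x). fls_const c * t + x) ` (UNIV \<times> V)) (\<lambda>w. s w + layer V t s w)"
    (is "stage ?W ?s")
proof -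
  define S where "S = (\<lambda>i. \<Sum>v\<in>V. inverse (t + v) ^ i)"
  have fin: "finite V" and zero: "0 \<in> V" and add: "\<And>x y. x \<in> V \<Longrightarrow> y \<in> V \<Longrightarrow> x + y \<in> V"
    and scal: "\<And>c x. x \<in> V \<Longrightarrow> fls_const c * x \<in> V" and unit: "s [] = 1"
    and ps: "\<And>j. 0 < j \<Longrightarrow> (\<Sum>v\<in>V. inverse v ^ j) = - (if (CARD('k) - 1) dvd j then s [Letter j] else 0)"
    and sh: "\<And>u v. lin_ext s (shuffle_word u v) = s u * s v"
    using st by (auto simp: stage_def)
  have inj: "inj_on (\<lambda>(c, x). fls_const c * t + x) (UNIV \<times> V)"
  proof (rule inj_onI, clarify)
    fix c d x y assume xy: "x \<in> V" "y \<in> V" and eq: "fls_const c * t + x = fls_const d * t + y"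
    have eq': "fls_const (c - d) * t = y - x"
      using eq by (simp add: fls_minus_const[symmetric] algebra_simps)
    have "c = d"
    proof (rule ccontr)
      assume "c \<noteq> d"
      then have "t = fls_const (inverse (c - d)) * (y - x)"
        unfolding eq'[symmetric] by (simp add: mult.assoc[symmetric])
      then show False
        using t scal[OF stage_minus[OF st xy(2,1)]] by simp
    qed
    then show "c = d \<and> x = y"
      using eq by simp
  qed
  have "x + y \<in> ?W" if "x \<in> ?W" "y \<in> ?W" for x y
  proof -
    from that obtain c d v w where "v \<in> V" "w \<in> V" "x = fls_const c * t + v" "y = fls_const d * t + w"
      by auto
    then have "x + y = fls_const (c + d) * t + (v + w)" "v + w \<in> V"
      using add by (simp_all add: fls_plus_const[symmetric] algebra_simps)
    then show ?thesis
      by force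
  qed
  moreover have "fls_const c * x \<in> ?W" if "x \<in> ?W" for c x
  proof -
    from that obtain d v where "v \<in> V" "x = fls_const d * t + v"
      by auto
    then have "fls_const c * x = fls_const (c * d) * t + fls_const c * v" "fls_const c * v \<in> V"
      using scal by (simp_all add: fls_const_mult_const[symmetric] algebra_simps del: fls_const_mult_const)
    then show ?thesis
      by force
  qed
  moreover have "0 \<in> ?W"
    using zero by (intro image_eqI[of _ _ "(0, 0)"]) auto
  moreover have "(\<Sum>v\<in>?W. inverse v ^ j) = - (if (CARD('k) - 1) dvd j then ?s [Letter j] else 0)"
    if j: "j > 0" for j
  proof -
    have coset: "(\<Sum>x\<in>V. inverse (fls_const c * t + x) ^ j) = fls_const (inverse c ^ j) * S j"
      if c: "c \<noteq> 0" for c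
    proof -
      have "(\<Sum>x\<in>V. inverse (fls_const c * t + x) ^ j) = (\<Sum>x\<in>V. inverse (fls_const c * (t + x)) ^ j)"
        using c scal
        by (intro sum.reindex_bij_witness[of _ "\<lambda>x. fls_const c * x" "\<lambda>x. fls_const (inverse c) * x"])
          (auto simp: distrib_left mult.assoc[symmetric])
      also have "\<dots> = fls_const (inverse c ^ j) * S j"
        by (simp add: S_def sum_distrib_left power_mult_distrib fls_const_power fls_inverse_const)
      finally show ?thesis .
    qed
    have "(\<Sum>v\<in>?W. inverse v ^ j) = (\<Sum>c\<in>UNIV. \<Sum>x\<in>V. inverse (fls_const c * t + x) ^ j)"
      by (subst sum.reindex[OF inj]) (simp add: sum.cartesian_product case_prod_unfold)
    also have "\<dots> = (\<Sum>x\<in>V. inverse x ^ j) + (\<Sum>c\<in>UNIV - {0}. fls_const (inverse c ^ j) * S j)"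
      by (subst sum.remove[of _ 0]) (simp_all add: coset)
    also have "(\<Sum>c\<in>UNIV - {0}. fls_const (inverse c ^ j) * S j)
        = fls_const (\<Sum>c\<in>UNIV - {0 :: 'k}. inverse c ^ j) * S j"
    proof -
      have "fls_const (\<Sum>c\<in>A. f c) = (\<Sum>c\<in>A. fls_const (f c))" for f :: "'k \<Rightarrow> 'k" and A
        by (induction A rule: infinite_finite_induct) (simp_all add: fls_plus_const[symmetric])
      then show ?thesis
        by (simp add: sum_distrib_right)
    qed
    finally show ?thesis
      unfolding ps[OF j] sum_units_inverse_power using j by (simp add: S_def unit)
  qed
  moreover have "lin_ext ?s (shuffle_word u v) = ?s u * ?s v" for u v
  proof -
    consider "u = []" | "v = []" | a u' b v' where "u = a # u'" "v = b # v'"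
      by (cases u; cases v) auto
    then show ?thesis
    proof cases
      case 1
      then show ?thesis
        by (simp add: unit)
    next
      case 2
      then show ?thesis
        by (cases u) (simp_all add: unit)
    next
      case 3
      have letter: "lin_ext (layer V t s) (basis [c] \<cdot> P) = S (wt c) * lin_ext s P" for c P
        by (intro lin_ext_conc_letter) (simp add: S_def)
      \<comment> \<open>With \<open>L\<close> the layer, the three terms of the recursion become
        \<open>L u * s v\<close>, \<open>s u * L v\<close> and \<open>L u * L v\<close>; adding
        \<open>s u * s v\<close> completes \<open>(s u + L u) * (s v + L v)\<close>.\<close>
      have "lin_ext (layer V t s) (shuffle_word u v) = S (wt a) * (s u' * s v) + S (wt b) * (s u * s v')
          + layer V t s u * layer V t s v"
        unfolding 3 shuffle_word.simps lin_ext_add layer_diamond_word[OF st t] letter sh ..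
      then show ?thesis
        by (simp add: lin_ext_fun_add sh 3 S_def algebra_simps del: shuffle_word.simps)
    qed
  qed
  ultimately show ?thesis
    using fin unit unfolding stage_def by simp
qed

section \<open>Start and construction of the tower\<close>

definition counit :: "word \<Rightarrow> 'k::{field,finite} fls" where
  "counit w = (if w = [] then 1 else 0)"

lemma counit_simps [simp]: "counit [] = 1" "counit (a # u) = 0"
  by (simp_all add: counit_def)

lemma lin_ext_counit: "lin_ext counit P = fls_const (Poly_Mapping.lookup P [])"
  by (subst lin_ext_superset[of "insert [] (Poly_Mapping.keys P)"])
    (auto simp: counit_def sum.insert_remove intro!: sum.neutral)

lemma lin_ext_counit_conc: "lin_ext counit (basis [a] \<cdot> P) = 0"
  using lin_ext_conc_letter[of counit a 0 counit P] by simp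

lemma lin_ext_counit_diamond_word: "lin_ext counit (diamond_word (a # u) (b # v)) = 0"
  by (simp add: lin_ext_add lin_ext_sum lin_ext_scale lin_ext_counit_conc)

lemma lin_ext_counit_shuffle_word: "lin_ext counit (shuffle_word (a # u) (b # v)) = 0"
  unfolding shuffle_word.simps lin_ext_add lin_ext_counit_conc lin_ext_counit_diamond_word by simp

text \<open>The zero space with \<open>S\<^sub><\<^sub>0\<close>, an empty sum except for the value
  1 on the empty word. As \<open>inverse 0 = 0\<close>, both sides of the power sum clause vanish;
  shuffles of nonempty words have no constant term.\<close>

lemma stage_counit: "stage {0} (counit :: word \<Rightarrow> 'k::{field,finite} fls)"
proof -
  have "lin_ext counit (shuffle_word u v) = counit u * (counit v :: 'k fls)" for u v
    by (cases u; cases v)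
      (simp_all add: lin_ext_counit_shuffle_word del: shuffle_word.simps(3))
  then show ?thesis
    by (simp add: stage_def counit_def)
qed

lemma ex_stage_sequence:
  "\<exists>(V :: nat \<Rightarrow> 'k::{field,finite} fls set) s t. s 0 = counit \<and> (\<forall>d. stage (V d) (s d)
     \<and> generic (V d) (s d) (t d) \<and> s (Suc d) = (\<lambda>w. s d w + layer (V d) (t d) (s d) w))"
proof -
  let ?P = "\<lambda>(n::nat) x. stage (fst x) (snd x) \<and> (n = 0 \<longrightarrow> snd x = (counit :: word \<Rightarrow> 'k fls))"
  \<comment> \<open>Only the functionals carry a recursion; of the next space, \<open>stage\<close>
    is all that is retained.\<close>
  let ?Q = "\<lambda>x y. \<exists>t. generic (fst x) (snd x) t \<and> snd y = (\<lambda>w. snd x w + layer (fst x) t (snd x) w)"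
  have "\<exists>f. \<forall>n. ?P n (f n) \<and> ?Q (f n) (f (Suc n))"
  proof (rule dependent_nat_choice)
    show "\<exists>x. ?P 0 x"
      using stage_counit by (intro exI[of _ "({0}, counit)"]) simp
  next
    fix x :: "'k fls set \<times> (word \<Rightarrow> 'k fls)" and n assume x: "?P n x"
    then obtain t where t: "generic (fst x) (snd x) t"
      using ex_generic[of "fst x" "snd x"] stage_uminus[of "fst x" "snd x"] by (auto simp: stage_def)
    then have "t \<notin> fst x"
      by (simp add: generic_def)
    with x have "stage ((\<lambda>(c, x). fls_const c * t + x) ` (UNIV \<times> fst x)) (\<lambda>w. snd x w + layer (fst x) t (snd x) w)"
      by (intro stage_step) auto
    with t show "\<exists>y. ?P (Suc n) y \<and> ?Q x y"
      by (intro exI[of _ "((\<lambda>(c, x). fls_const c * t + x) ` (UNIV \<times> fst x), \<lambda>w. snd x w + layer (fst x) t (snd x) w)"])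
        auto
  qed
  then obtain f where f: "\<And>n. ?P n (f n)" "\<And>n. ?Q (f n) (f (Suc n))"
    by blast
  from f(2) obtain t where "\<And>n. generic (fst (f n)) (snd (f n)) (t n)
      \<and> snd (f (Suc n)) = (\<lambda>w. snd (f n) w + layer (fst (f n)) (t n) (snd (f n)) w)"
    by metis
  with f(1) show ?thesis
    by (intro exI[of _ "fst \<circ> f"] exI[of _ "snd \<circ> f"] exI[of _ t]) auto
qed

section \<open>Separation of points and the algebra laws\<close>

theorem theorem6p9:
  shows "algebra (base_field :: 'k::{field,finite} ring) (word_algebra diamond)
    \<and> algebra (base_field :: 'k ring) (word_algebra shuffle)
    \<and> (\<forall>P Q R :: 'k words. shuffle (shuffle P Q) R = shuffle P (shuffle Q R))"
proof -
  obtain V :: "nat \<Rightarrow> 'k fls set" and s t where s0: "s 0 = counit"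
    and stage: "\<And>d. stage (V d) (s d)" and gen: "\<And>d. generic (V d) (s d) (t d)"
    and s_Suc: "\<And>d. s (Suc d) = (\<lambda>w. s d w + layer (V d) (t d) (s d) w)"
    using ex_stage_sequence by metis
  \<comment> \<open>A coefficient is reached by stripping letters from its word: differences of
    consecutive \<open>s d\<close> are layers, genericity passes to the left quotient, and
    \<open>s 0\<close> reads off the coefficient of the empty word.\<close>
  have separating: "P = 0" if "\<And>d. lin_ext (s d) P = 0" for P
  proof (rule poly_mapping_eqI)
    fix w show "Poly_Mapping.lookup P w = Poly_Mapping.lookup 0 w"
      using that
    proof (induction w arbitrary: P)
      case Nil
      from Nil[of 0] show ?case
        by (simp add: s0 lin_ext_counit)
    next
      case (Cons a w)
      have "lin_ext (layer (V d) (t d) (s d)) P = 0" for d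
        using Cons.prems[of "Suc d"] Cons.prems[of d] by (simp add: s_Suc lin_ext_fun_add)
      then have "lin_ext (s d) (Poly_Mapping.map_key ((#) a) P) = 0" for d
        using gen[of d] by (simp add: generic_def)
      from Cons.IH[OF this] show ?case
        by (simp add: map_key.rep_eq)
    qed
  qed
  have shuffle: "algebra (base_field :: 'k ring) (word_algebra shuffle)"
    unfolding shuffle_def
    by (rule algebra_if_separating_characters[of s])
      (use stage in \<open>auto simp: stage_def intro: separating\<close>)
  \<comment> \<open>The counit is listed separately: the layers alone do not separate the empty word.\<close>
  define \<chi> where "\<chi> = case_nat counit (\<lambda>d w. counit w + layer (V d) (t d) (s d) w)"
  have "algebra (base_field :: 'k ring) (word_algebra diamond)"
    unfolding diamond_def
  proof (rule algebra_if_separating_characters[of \<chi>])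
    show "\<chi> i [] = 1" for i
      by (simp add: \<chi>_def split: nat.split)
    show "lin_ext (\<chi> i) (diamond_word u v) = \<chi> i u * \<chi> i v" for i u v
    proof -
      consider "u = []" | "v = []" | a u' b v' where "u = a # u'" "v = b # v'"
        by (cases u; cases v) auto
      then show ?thesis
      proof cases
        case 3
        have "t d \<notin> V d" for d
          using gen[of d] by (simp add: generic_def)
        then show ?thesis
          unfolding 3 by (simp add: \<chi>_def lin_ext_fun_add lin_ext_counit_diamond_word layer_diamond_word[OF stage]
              del: diamond_word.simps split: nat.split)
      qed (cases u, simp_all add: \<open>\<And>i. \<chi> i [] = 1\<close>)+
    qed
    fix P assume P: "\<And>i. lin_ext (\<chi> i) P = 0"
    have "lin_ext (layer (V d) (t d) (s d)) P = 0" for d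
      using P[of 0] P[of "Suc d"] by (simp add: \<chi>_def lin_ext_fun_add)
    \<comment> \<open>\<open>s d\<close> is the counit plus the layers below \<open>d\<close>, each
      of which vanishes on \<open>P\<close>.\<close>
    then have "lin_ext (s d) P = 0" for d
      using P[of 0] by (induction d) (simp_all add: s0 s_Suc lin_ext_fun_add \<chi>_def)
    then show "P = 0"
      by (rule separating)
  qed
  moreover have "shuffle (shuffle P Q) R = shuffle P (shuffle Q R)" for P Q R :: "'k words"
  proof -
    interpret cring "word_algebra (shuffle :: 'k words \<Rightarrow> _)"
      by (rule algebra.M_cring[OF shuffle])
    show ?thesis
      using m_assoc[of P Q R] by (simp add: word_algebra_def)
  qed
  ultimately show ?thesis
    using shuffle by blast
qed

end
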